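(* Let $S=\langle\mathbf{a}_1,\dots,\mathbf{a}_k\rangle$ be the affine monoid generated by $\mathbf{a}_1,\dots,\mathbf{a}_k\in\mathbb{Z}_{\ge 0}^d\setminus\{0\}$, and let $\Lambda=\{\mathbf{a}_{k-n+1},\dots,\mathbf{a}_k\}$, $n\le k$, be such that $pos(S)=pos(\Lambda)$. Let $\prec_\Lambda$ be a block ordering on $\mathbb{Q}[x_1,\dots,x_d,y_1,\dots,y_k]$ of the type described in the context. Then $$\mathcal{Q}_{\prec_\Lambda}(S)=Ap(S,\Lambda).$$
   Context: $S=\langle\mathbf{a}_1,\dots,\mathbf{a}_k\rangle$ is the set of all $\mathbb{Z}_{\ge 0}$-linear combinations of $\mathbf{a}_1,\dots,\mathbf{a}_k$. Write $\mathbf{a}_j=(a_{1j},\dots,a_{dj})$. For a finite set of vectors $\{\mathbf{b}_1,\dots,\mathbf{b}_m\}$, $pos(\{\mathbf{b}_1,\dots,\mathbf{b}_m\})$ is the rational cone $\{\lambda_1\mathbf{b}_1+\dots+\lambda_m\mathbf{b}_m\mid\lambda_i\in\mathbb{Q}_{\ge0}\}$, and $pos(S)=pos(\{\mathbf{a}_1,\dots,\mathbf{a}_k\})$. Apéry set of $S$ with respect to $\Lambda$: $Ap(S,\Lambda)=\{\mathbf{a}\in S\mid \mathbf{a}-\mathbf{b}\notin S\ \text{for all}\ \mathbf{b}\in\Lambda\}$. Ordering: $\prec_\Lambda$ is a block (elimination) ordering which first compares the $x$-parts of two monomials by an arbitrary monomial ordering $\prec_x$ on $x_1,\dots,x_d$,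 and, if these coincide, compares the $y$-parts by an $S$-graded reverse lexicographical ordering $\prec_y$ on $y_1,\dots,y_k$ for which every variable $y_i$ with $i\in\{k-n+1,\dots,k\}$ is smaller than every variable $y_j$ with $j\in\{1,\dots,k-n\}$. Here "$S$-graded reverse lexicographical" means: first the $S$-degrees $\sum_i u_i\mathbf{a}_i\in\mathbb{Z}_{\ge0}^d$ of the monomials $\mathbf{y}^{\mathbf{u}}$ are compared (by a fixed monomial ordering on $\mathbb{Z}_{\ge 0}^d$, e.g. the lexicographic one); ties are broken reverse lexicographically, i.e. for distinct monomials of the same $S$-degree, look at the smallest variable in which the exponents differ, and the monomial with the larger exponent there is the smaller monomial. For example, for $y_k\prec_y\dots\prec_y y_1$, ties are broken by declaring smaller the monomial with larger exponent of $y_k$, then of $y_{k-1}$, and so on. Ideal: $I_S$ is the kernel of the ring homomorphism $\mathbb{Q}[x_1,\dots,x_d,y_1,\dots,y_k]\to\mathbb{Q}[x_1,\dots,x_d]$ with $y_j\mapsto\mathbf{x}^{\mathbf{a}_j}:=x_1^{a_{1j}}\cdots x_d^{a_{dj}}$ and $x_i\mapsto x_i$. Let $\mathcal{B}_\Lambda$ be the reduced Groebner basis of $I_S$ with respect to $\prec_\Lambda$ and $N_\Lambda$ the normal form operator with respect to $\mathcal{B}_\Lambda$ (the normal form of a monomial is a monomial). For a nonzero polynomial $g$, $\exp(g)\in\mathbb{Z}_{\ge0}^{d+k}$ is the exponent of its leading monomial with respect to $\prec_\Lambda$. Let $E(I_S)=\bigcup_{g\in\mathcal{B}_\Lambda}\left(\exp(g)+\mathbb{Z}_{\ge0}^{d+k}\right)$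 and $\overline{E(I_S)}=\mathbb{Z}_{\ge0}^{d+k}\setminus E(I_S)$. Write $z_1,\dots,z_n$ for $y_{k-n+1},\dots,y_k$; coordinates of $\mathbb{Z}_{\ge0}^{d+k}$ are named after the variables. Define $$\mathcal{Q}_{\prec_\Lambda}(S)=\left\{\mathbf{a}\in\mathbb{Z}_{\ge0}^d\mid\exp\left(N_\Lambda(\mathbf{x}^{\mathbf{a}})\right)\in\{x_1=\dots=x_d=z_1=\dots=z_n=0\}\cap\overline{E(I_S)}\right\}.$$ *)

theory Defs
  imports "HOL-Analysis.Finite_Cartesian_Product" "HOL-Library.Poly_Mapping"
begin

section \<open>Affine monoids, cones and Apery sets\<close>

text \<open>
  Vectors in \<open>\<int>\<^sub>\<ge>\<^sub>0\<^sup>d\<close> are elements of \<open>nat ^ 'd\<close> with \<open>d = CARD('d)\<close>, and the generators form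
  a family \<open>a\<close> indexed by a finite type \<open>'k\<close> with \<open>k = CARD('k)\<close>. The index type carries no order;
  the distinguished generators (the last \<open>n\<close> of them, up to relabelling) are given by an index set
  \<open>Z\<close> with \<open>n = card Z\<close>, and \<open>\<Lambda> = a ` Z\<close>.
\<close>

definition S_degree :: "('k::finite \<Rightarrow> nat ^ 'd::finite) \<Rightarrow> nat ^ 'k \<Rightarrow> nat ^ 'd" where
  "S_degree a u = (\<Sum>j\<in>UNIV. (u $ j) *s a j)"

definition affine_monoid :: "('k::finite \<Rightarrow> nat ^ 'd::finite) \<Rightarrow> (nat ^ 'd) set" where
  "affine_monoid a = {S_degree a u | u. True}"

definition int_vec :: "nat ^ 'd::finite \<Rightarrow> int ^ 'd" where
  "int_vec v = (\<chi> i. int (v $ i))"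

definition rat_vec :: "nat ^ 'd::finite \<Rightarrow> rat ^ 'd" where
  "rat_vec v = (\<chi> i. of_nat (v $ i))"

definition rat_cone :: "(nat ^ 'd::finite) set \<Rightarrow> (rat ^ 'd) set" where
  "rat_cone M = {(\<Sum>b\<in>M. l b *s rat_vec b) | l. \<forall>b\<in>M. 0 \<le> l b}"

text \<open>The difference is taken in \<open>\<int>\<^sup>d\<close>, since subtraction on \<^typ>\<open>nat\<close> truncates.\<close>

definition Apery :: "(nat ^ 'd::finite) set \<Rightarrow> (nat ^ 'd) set \<Rightarrow> (nat ^ 'd) set" where
  "Apery S L = {s \<in> S. \<forall>b\<in>L. int_vec s - int_vec b \<notin> int_vec ` S}"

section \<open>Monomial orderings\<close>

definition strict_total :: "('v \<Rightarrow> 'v \<Rightarrow> bool) \<Rightarrow> bool" where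
  "strict_total prec \<longleftrightarrow> irreflp prec \<and> transp prec \<and> totalp prec"

definition monomial_order :: "(nat ^ 'v::finite \<Rightarrow> nat ^ 'v \<Rightarrow> bool) \<Rightarrow> bool" where
  "monomial_order prec \<longleftrightarrow>
     strict_total prec \<and> wfp prec \<and> (\<forall>u v w. prec u v \<longrightarrow> prec (u + w) (v + w))"

text \<open>
  In \<open>S_graded_revlex\<close>, \<open>gless\<close> compares the \<open>S\<close>-degrees, and \<open>vless i j\<close> means that the variable
  \<open>y\<^sub>i\<close> is smaller than \<open>y\<^sub>j\<close>; the index \<open>i\<close> below is the smallest variable in which \<open>u\<close> and \<open>v\<close>
  differ, and the larger exponent there gives the smaller monomial.
\<close>

definition S_graded_revlex ::
  "('k::finite \<Rightarrow> nat ^ 'd::finite) \<Rightarrow> (nat ^ 'd \<Rightarrow> nat ^ 'd \<Rightarrow> bool) \<Rightarrow> ('k \<Rightarrow> 'k \<Rightarrow> bool)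
    \<Rightarrow> nat ^ 'k \<Rightarrow> nat ^ 'k \<Rightarrow> bool" where
  "S_graded_revlex a gless vless u v \<longleftrightarrow>
     gless (S_degree a u) (S_degree a v) \<or>
     (S_degree a u = S_degree a v \<and>
       (\<exists>i. u $ i > v $ i \<and> (\<forall>j. vless j i \<longrightarrow> u $ j = v $ j)))"

text \<open>
  Exponents of monomials in \<open>x\<^sub>1, \<dots>, x\<^sub>d, y\<^sub>1, \<dots>, y\<^sub>k\<close> are elements of \<open>nat ^ ('d + 'k)\<close>, where
  \<open>Inl i\<close> is the coordinate of \<open>x\<^sub>i\<close> and \<open>Inr j\<close> that of \<open>y\<^sub>j\<close>.
\<close>

definition x_part :: "nat ^ ('d::finite + 'k::finite) \<Rightarrow> nat ^ 'd" where
  "x_part w = (\<chi> i. w $ Inl i)"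

definition y_part :: "nat ^ ('d::finite + 'k::finite) \<Rightarrow> nat ^ 'k" where
  "y_part w = (\<chi> j. w $ Inr j)"

definition block_order ::
  "(nat ^ 'd::finite \<Rightarrow> nat ^ 'd \<Rightarrow> bool) \<Rightarrow> (nat ^ 'k::finite \<Rightarrow> nat ^ 'k \<Rightarrow> bool)
    \<Rightarrow> nat ^ ('d + 'k) \<Rightarrow> nat ^ ('d + 'k) \<Rightarrow> bool" where
  "block_order xless yless w w' \<longleftrightarrow>
     xless (x_part w) (x_part w') \<or> (x_part w = x_part w' \<and> yless (y_part w) (y_part w'))"

section \<open>Polynomials, Groebner bases and normal forms\<close>

text \<open>
  The polynomial ring over the rationals in variables indexed by \<open>'v\<close> is the monoid ring of
  \<open>nat ^ 'v\<close>; multiplication of \<^type>\<open>poly_mapping\<close> is convolution.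
\<close>

type_synonym 'v mpol = "(nat ^ 'v) \<Rightarrow>\<^sub>0 rat"

abbreviation monomial :: "nat ^ 'v::finite \<Rightarrow> 'v mpol" where
  "monomial m \<equiv> Poly_Mapping.single m 1"

abbreviation const_pol :: "rat \<Rightarrow> 'v::finite mpol" where
  "const_pol c \<equiv> Poly_Mapping.single 0 c"

text \<open>
  The ring homomorphism from \<open>\<rat>[x, y]\<close> to \<open>\<rat>[x]\<close> substituting \<open>x\<^sub>i\<close> for \<open>x\<^sub>i\<close> and the monomial with
  exponent \<open>a j\<close> for \<open>y\<^sub>j\<close>; \<open>axis i 1\<close> is the \<open>i\<close>-th unit vector.
\<close>

definition toric_hom ::
  "('k::finite \<Rightarrow> nat ^ 'd::finite) \<Rightarrow> ('d + 'k) mpol \<Rightarrow> 'd mpol" where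
  "toric_hom a p = (\<Sum>m\<in>Poly_Mapping.keys p. const_pol (Poly_Mapping.lookup p m) *
      (\<Prod>i\<in>UNIV. monomial (axis i 1) ^ (m $ Inl i)) * (\<Prod>j\<in>UNIV. monomial (a j) ^ (m $ Inr j)))"

definition toric_ideal :: "('k::finite \<Rightarrow> nat ^ 'd::finite) \<Rightarrow> ('d + 'k) mpol set" where
  "toric_ideal a = {p. toric_hom a p = 0}"

definition lead_exp :: "(nat ^ 'v::finite \<Rightarrow> nat ^ 'v \<Rightarrow> bool) \<Rightarrow> 'v mpol \<Rightarrow> nat ^ 'v" where
  "lead_exp prec p =
     (THE m. m \<in> Poly_Mapping.keys p \<and> (\<forall>m'\<in>Poly_Mapping.keys p. m' \<noteq> m \<longrightarrow> prec m' m))"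

definition lead_coef :: "(nat ^ 'v::finite \<Rightarrow> nat ^ 'v \<Rightarrow> bool) \<Rightarrow> 'v mpol \<Rightarrow> rat" where
  "lead_coef prec p = Poly_Mapping.lookup p (lead_exp prec p)"

definition lead_exps :: "(nat ^ 'v::finite \<Rightarrow> nat ^ 'v \<Rightarrow> bool) \<Rightarrow> 'v mpol set \<Rightarrow> (nat ^ 'v) set" where
  "lead_exps prec G = (\<Union>g\<in>G. {lead_exp prec g + t | t. True})"

definition groebner_basis ::
  "(nat ^ 'v::finite \<Rightarrow> nat ^ 'v \<Rightarrow> bool) \<Rightarrow> 'v mpol set \<Rightarrow> 'v mpol set \<Rightarrow> bool" where
  "groebner_basis prec I G \<longleftrightarrow>
     finite G \<and> G \<subseteq> I - {0} \<and> (\<forall>f\<in>I - {0}. lead_exp prec f \<in> lead_exps prec G)"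

definition reduced_groebner_basis ::
  "(nat ^ 'v::finite \<Rightarrow> nat ^ 'v \<Rightarrow> bool) \<Rightarrow> 'v mpol set \<Rightarrow> 'v mpol set \<Rightarrow> bool" where
  "reduced_groebner_basis prec I G \<longleftrightarrow>
     groebner_basis prec I G \<and>
     (\<forall>g\<in>G. lead_coef prec g = 1 \<and> Poly_Mapping.keys g \<inter> lead_exps prec (G - {g}) = {})"

definition reduction_step ::
  "(nat ^ 'v::finite \<Rightarrow> nat ^ 'v \<Rightarrow> bool) \<Rightarrow> 'v mpol set \<Rightarrow> 'v mpol \<Rightarrow> 'v mpol \<Rightarrow> bool" where
  "reduction_step prec G f h \<longleftrightarrow>
     (\<exists>g\<in>G. \<exists>t. lead_exp prec g + t \<in> Poly_Mapping.keys f \<and>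
        h = f - Poly_Mapping.single t
              (Poly_Mapping.lookup f (lead_exp prec g + t) / lead_coef prec g) * g)"

text \<open>Unique existence of the remainder below holds when \<open>G\<close> is a Groebner basis of an ideal.\<close>

definition normal_form ::
  "(nat ^ 'v::finite \<Rightarrow> nat ^ 'v \<Rightarrow> bool) \<Rightarrow> 'v mpol set \<Rightarrow> 'v mpol \<Rightarrow> 'v mpol" where
  "normal_form prec G f =
     (THE r. (reduction_step prec G)\<^sup>*\<^sup>* f r \<and> (\<nexists>h. reduction_step prec G r h))"

definition x_exponent :: "nat ^ 'd::finite \<Rightarrow> nat ^ ('d + 'k::finite)" where
  "x_exponent v = (\<chi> s. case s of Inl i \<Rightarrow> v $ i | Inr j \<Rightarrow> 0)"

definition Q_set ::
  "(nat ^ ('d::finite + 'k::finite) \<Rightarrow> nat ^ ('d + 'k) \<Rightarrow> bool) \<Rightarrow> ('d + 'k) mpol set \<Rightarrow> 'k set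
    \<Rightarrow> (nat ^ 'd) set" where
  "Q_set prec B Z =
     {v. lead_exp prec (normal_form prec B (monomial (x_exponent v)))
           \<in> {w. (\<forall>i. w $ Inl i = 0) \<and> (\<forall>j\<in>Z. w $ Inr j = 0)} \<inter> - lead_exps prec B}"

end

theory Submission
  imports Defs "HOL-Library.Multiset"
begin

text \<open>
  Grade \<open>\<rat>[x, y]\<close> by letting \<open>x\<^sup>v y\<^sup>u\<close> have degree \<open>v + \<Sum>\<^sub>j u\<^sub>j a\<^sub>j\<close>. A polynomial lies in
  \<open>I\<^sub>S\<close> iff its coefficients sum to zero in each degree, so the normal form of \<open>x\<^sup>v\<close> is the smallest
  monomial of degree \<open>v\<close>. Elimination makes its \<open>x\<close>-part trivial exactly when \<open>v \<in> S\<close>.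
  In that case, since the variables of \<open>\<Lambda>\<close> are the smallest ones and revlex prefers large exponents
  of small variables, the smallest monomial avoids them exactly when all
  factorizations of \<open>v\<close> do, that is, when \<open>v\<close> is an Apery element.
\<close>

section \<open>Monomial orders\<close>

lemma strict_totalD:
  assumes "strict_total R"
  shows "\<not> R x x" "R x y \<Longrightarrow> R y z \<Longrightarrow> R x z" "x \<noteq> y \<Longrightarrow> R x y \<or> R y x"
  using assms unfolding strict_total_def irreflp_def transp_def totalp_on_def by blast+

lemma strict_total_flip:
  assumes "strict_total R" shows "strict_total (\<lambda>x y. R y x)"
  unfolding strict_total_def irreflp_def transp_def totalp_on_def
  using strict_totalD[OF assms] by blast

lemma strict_total_ex_greatest:
  assumes "strict_total R" "finite A" "A \<noteq> {}"
  shows "\<exists>m\<in>A. \<forall>x\<in>A. x \<noteq> m \<longrightarrow> R x m"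
  using assms(2,3)
proof (induction A rule: finite_ne_induct)
  case (insert b A)
  then obtain m where m: "m \<in> A" "\<forall>x\<in>A. x \<noteq> m \<longrightarrow> R x m" by blast
  show ?case
    using m insert.hyps strict_totalD[OF assms(1)] by (cases "R b m") (metis insert_iff)+
qed simp

lemma strict_total_ex_least:
  assumes "strict_total R" "finite A" "A \<noteq> {}"
  shows "\<exists>m\<in>A. \<forall>x\<in>A. x \<noteq> m \<longrightarrow> R m x"
  using strict_total_ex_greatest[OF strict_total_flip[OF assms(1)] assms(2,3)] .

lemma monomial_orderD:
  assumes "monomial_order prec"
  shows "strict_total prec" "wfp prec" "prec u v \<Longrightarrow> prec (u + w) (v + w)"
  using assms unfolding monomial_order_def by blast+

lemma wfp_ex_minimal:
  assumes "wfp R" "x \<in> A"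
  obtains m where "m \<in> A" "\<forall>y. R y m \<longrightarrow> y \<notin> A"
  using assms unfolding wfp_iff_ex_minimal by (metis empty_iff)

lemma monomial_order_zero_least:
  assumes "monomial_order prec" "u \<noteq> 0"
  \<comment> \<open>Translation invariance turns \<open>prec m 0\<close> into
    \<open>prec (m + m) m\<close>. Hence no exponent below 0 could be minimal among those below 0,
    against well-foundedness.\<close>
  shows "prec 0 u"
proof (rule ccontr)
  note D = monomial_orderD[OF assms(1)]
  assume "\<not> prec 0 u"
  then have "u \<in> {u. prec u 0}"
    using strict_totalD(3)[OF D(1), of u 0] assms(2) by auto
  then obtain m where m: "prec m 0" "\<And>y. prec y m \<Longrightarrow> \<not> prec y 0"
    using wfp_ex_minimal[OF D(2), of u "{u. prec u 0}"] by auto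
  have "prec (m + m) m" using D(3)[OF m(1), of m] by simp
  then show False using m strict_totalD(2)[OF D(1)] by blast
qed

text \<open>A finite nonempty support has exactly one greatest element in a strict total order,
  which justifies the definite description in \<open>lead_exp\<close>.\<close>

lemma lead_exp_greatest:
  assumes "strict_total prec" "p \<noteq> 0"
  shows "lead_exp prec p \<in> Poly_Mapping.keys p"
    and "\<And>m. m \<in> Poly_Mapping.keys p \<Longrightarrow> m \<noteq> lead_exp prec p \<Longrightarrow> prec m (lead_exp prec p)"
proof -
  have "\<exists>!m. m \<in> Poly_Mapping.keys p \<and> (\<forall>m'\<in>Poly_Mapping.keys p. m' \<noteq> m \<longrightarrow> prec m' m)"
  proof (rule ex_ex1I)
    show "\<exists>m. m \<in> Poly_Mapping.keys p \<and> (\<forall>m'\<in>Poly_Mapping.keys p. m' \<noteq> m \<longrightarrow> prec m' m)"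
      using strict_total_ex_greatest[OF assms(1), of "Poly_Mapping.keys p"] assms(2) by auto
  qed (use strict_totalD(1,2)[OF assms(1)] in metis)
  from theI'[OF this, folded lead_exp_def]
  show "lead_exp prec p \<in> Poly_Mapping.keys p"
    and "\<And>m. m \<in> Poly_Mapping.keys p \<Longrightarrow> m \<noteq> lead_exp prec p \<Longrightarrow> prec m (lead_exp prec p)"
    by blast+
qed

lemma lead_exp_monomial: "lead_exp prec (monomial m) = m"
  unfolding lead_exp_def by (rule the_equality) auto

section \<open>Normal forms\<close>

lemma lookup_single_mult:
  fixes g :: "'v::finite mpol"
  shows "Poly_Mapping.lookup (Poly_Mapping.single t c * g) (t + m) = c * Poly_Mapping.lookup g m"
  by (simp add: lookup_mult lookup_single when_mult)

lemma keys_single_mult: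
  fixes g :: "'v::finite mpol"
  shows "Poly_Mapping.keys (Poly_Mapping.single t c * g) \<subseteq> (+) t ` Poly_Mapping.keys g"
  using keys_mult[of "Poly_Mapping.single t c" g] by (auto split: if_splits)

lemma irreducible_iff:
  "(\<nexists>h. reduction_step prec G r h) \<longleftrightarrow> Poly_Mapping.keys r \<inter> lead_exps prec G = {}"
  unfolding reduction_step_def lead_exps_def by blast

text \<open>This is the termination measure for reduction. A step deletes the key
  \<open>lead_exp prec g + t\<close>, and each key that it creates is a shifted non-leading key of
  \<open>g\<close>, hence smaller than the deleted one. Supports therefore decrease in the multiset
  extension of \<open>prec\<close>.\<close>

lemma reduction_step_multp:
  assumes ord: "monomial_order prec" and "0 \<notin> G" and step: "reduction_step prec G f h"
  shows "multp prec (mset_set (Poly_Mapping.keys h)) (mset_set (Poly_Mapping.keys f))"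
proof -
  note D = monomial_orderD[OF ord]
  from step obtain g t where g: "g \<in> G" and m: "lead_exp prec g + t \<in> Poly_Mapping.keys f"
    and h: "h = f - Poly_Mapping.single t
              (Poly_Mapping.lookup f (lead_exp prec g + t) / lead_coef prec g) * g"
    unfolding reduction_step_def by blast
  from g have "g \<noteq> 0" using \<open>0 \<notin> G\<close> by blast
  note L = lead_exp_greatest[OF D(1) this]
  let ?m = "lead_exp prec g + t"
  let ?A = "Poly_Mapping.keys f" and ?B = "Poly_Mapping.keys h"
  have "lead_coef prec g \<noteq> 0" using L(1) by (simp add: lead_coef_def in_keys_iff)
  \<comment> \<open>The scalar in the reduction step is chosen exactly so that the coefficient at
    \<open>?m\<close> cancels.\<close>
  then have m_out: "?m \<notin> ?B"
    using lookup_single_mult[of t _ g "lead_exp prec g"]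
    by (simp add: h in_keys_iff lookup_minus lead_coef_def add.commute)
  have small: "prec k ?m" if "k \<in> ?B - ?A" for k
  proof -
    from that have "k \<in> (+) t ` Poly_Mapping.keys g"
      unfolding h using keys_diff keys_single_mult by fastforce
    then obtain l where l: "l \<in> Poly_Mapping.keys g" "k = l + t" by (auto simp: add.commute)
    with that m have "l \<noteq> lead_exp prec g" by auto
    with L(2) l D(3) show ?thesis by blast
  qed
  \<comment> \<open>Splitting off the keys common to \<open>f\<close> and \<open>h\<close> leaves
    only the created and the deleted keys to be compared.\<close>
  have split: "mset_set X = mset_set (X \<inter> Y) + mset_set (X - Y)"
    if "finite X" for X Y :: "(nat ^ 'a) set"
  proof -
    have "(X \<inter> Y) \<inter> (X - Y) = {}" "(X \<inter> Y) \<union> (X - Y) = X" by blast+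
    then show ?thesis using mset_set_Union[of "X \<inter> Y" "X - Y"] that by simp
  qed
  have "multp prec (mset_set (?A \<inter> ?B) + mset_set (?B - ?A)) (mset_set (?A \<inter> ?B) + mset_set (?A - ?B))"
  proof (rule one_step_implies_multp)
    show "mset_set (?A - ?B) \<noteq> {#}" using m m_out by (auto simp: mset_set_empty_iff)
    show "\<forall>k\<in>#mset_set (?B - ?A). \<exists>j\<in>#mset_set (?A - ?B). prec k j"
      using m m_out small by auto
  qed
  then show ?thesis using split[of ?A ?B] split[of ?B ?A] by (simp add: Int_commute)
qed

lemma ex_irreducible:
  assumes "monomial_order prec" "0 \<notin> G"
  shows "\<exists>r. (reduction_step prec G)\<^sup>*\<^sup>* f r \<and> (\<nexists>h. reduction_step prec G r h)"
proof -
  let ?M = "\<lambda>f. mset_set (Poly_Mapping.keys f)"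
  let ?R = "{r. (reduction_step prec G)\<^sup>*\<^sup>* f r}"
  have "wfp (multp prec)" using monomial_orderD(2)[OF assms(1)] by (rule wfp_multp)
  moreover have "?M f \<in> ?M ` ?R" by blast
  \<comment> \<open>Among all polynomials reachable from \<open>f\<close>, one with minimal support
    admits no further step.\<close>
  ultimately obtain M where M: "M \<in> ?M ` ?R" "\<And>N. multp prec N M \<Longrightarrow> N \<notin> ?M ` ?R"
    using wfp_ex_minimal by metis
  then obtain r where r: "r \<in> ?R" "M = ?M r" by blast
  have "\<not> reduction_step prec G r h" for h
    using M(2)[of "?M h"] r reduction_step_multp[OF assms, of r h]
      rtranclp.rtrancl_into_rtrancl[of "reduction_step prec G" f r h] by blast
  then show ?thesis using r by blast
qed

text \<open>Two irreducible polynomials congruent to \<open>f\<close> differ by an element of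
  \<open>I\<close>. If the difference were nonzero, its leading exponent would lie in
  \<open>lead_exps prec G\<close> and also in the support of one of the two, contradicting
  irreducibility. Normal forms can thus be recognised without following any reduction.\<close>

lemma normal_form_eqI:
  assumes ord: "monomial_order prec" and gb: "groebner_basis prec I G"
    and zero: "0 \<in> I" and diff: "\<And>p q. p \<in> I \<Longrightarrow> q \<in> I \<Longrightarrow> p - q \<in> I"
    and mult: "\<And>t c p. p \<in> I \<Longrightarrow> Poly_Mapping.single t c * p \<in> I"
    and fr: "f - r \<in> I" and irr: "Poly_Mapping.keys r \<inter> lead_exps prec G = {}"
  shows "normal_form prec G f = r"
proof -
  note D = monomial_orderD[OF ord]
  have G: "0 \<notin> G" "G \<subseteq> I" "\<And>p. p \<in> I \<Longrightarrow> p \<noteq> 0 \<Longrightarrow> lead_exp prec p \<in> lead_exps prec G"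
    using gb unfolding groebner_basis_def by auto
  have congr: "f - s \<in> I" if "(reduction_step prec G)\<^sup>*\<^sup>* f s" for s
    using that
  proof (induction rule: rtranclp_induct)
    case (step s h)
    then obtain q where q: "q \<in> I" "h = s - q"
      unfolding reduction_step_def using G(2) mult by blast
    \<comment> \<open>The sum \<open>(f - s) + q\<close> is written with differences because closure
      of \<open>I\<close> is given for subtraction.\<close>
    have "f - h = (f - s) - (0 - q)" using q by simp
    then show ?case using step.IH q zero diff by metis
  qed (simp add: zero)
  have unique: "s = r"
    if "(reduction_step prec G)\<^sup>*\<^sup>* f s" "\<nexists>h. reduction_step prec G s h" for s
  proof (rule ccontr)
    assume "s \<noteq> r"
    then have nz: "s - r \<noteq> 0" by simp
    have "s - r = (f - r) - (f - s)" by simp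
    then have "s - r \<in> I" using diff[OF fr congr[OF that(1)]] by simp
    then have "lead_exp prec (s - r) \<in> lead_exps prec G" using G(3) nz by blast
    moreover have "lead_exp prec (s - r) \<in> Poly_Mapping.keys s \<union> Poly_Mapping.keys r"
      using lead_exp_greatest(1)[OF D(1) nz] keys_diff[of s r] by (rule subsetD[rotated])
    ultimately show False using irr irreducible_iff[of prec G s] that(2) by blast
  qed
  \<comment> \<open>No reduction from \<open>f\<close> to \<open>r\<close> is constructed: some
    irreducible polynomial is reachable, and \<open>unique\<close> identifies it with
    \<open>r\<close>.\<close>
  have "(reduction_step prec G)\<^sup>*\<^sup>* f r \<and> (\<nexists>h. reduction_step prec G r h)"
    using ex_irreducible[OF ord G(1), of f] unique by metis
  then show ?thesis unfolding normal_form_def using unique by (intro the_equality) auto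
qed

section \<open>The toric ideal\<close>

text \<open>This is the exponent of the image of a monomial under \<open>toric_hom\<close>, so the
  fibres of the grading are the sets of monomials with equal image.\<close>

definition total_degree :: "('k::finite \<Rightarrow> nat ^ 'd::finite) \<Rightarrow> nat ^ ('d + 'k) \<Rightarrow> nat ^ 'd" where
  "total_degree a w = x_part w + S_degree a (y_part w)"

lemma x_part_add [simp]: "x_part (v + w) = x_part v + x_part w"
  by (simp add: x_part_def vec_eq_iff)

lemma y_part_add [simp]: "y_part (v + w) = y_part v + y_part w"
  by (simp add: y_part_def vec_eq_iff)

lemma S_degree_add: "S_degree a (u + v) = S_degree a u + S_degree a v"
  by (simp add: S_degree_def vec_eq_iff sum.distrib algebra_simps)

lemma S_degree_zero [simp]: "S_degree a 0 = 0"
  by (simp add: S_degree_def vec_eq_iff)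

lemma S_degree_axis [simp]: "S_degree a (axis j (Suc 0)) = a j"
  by (simp add: S_degree_def vec_eq_iff axis_def if_distrib[of "\<lambda>x. x * _"] cong: if_cong)

lemma total_degree_add: "total_degree a (v + w) = total_degree a v + total_degree a w"
  by (simp add: total_degree_def S_degree_add algebra_simps)

lemma prod_monomial_power:
  fixes f :: "'i \<Rightarrow> nat ^ 'v::finite"
  assumes "finite A"
  shows "(\<Prod>i\<in>A. monomial (f i) ^ n i) = monomial (\<Sum>i\<in>A. n i *s f i)"
proof -
  have pow: "monomial m ^ l = monomial (l *s m)" for m :: "nat ^ 'v" and l
  proof (induction l)
    case 0
    have "0 *s m = 0" by (simp add: vec_eq_iff)
    then show ?case by simp
  next
    case (Suc l)
    have "Suc l *s m = m + l *s m" by (simp add: vec_eq_iff)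
    with Suc show ?case by (simp add: mult_single)
  qed
  show ?thesis using assms by (induction A rule: finite_induct) (simp_all add: pow mult_single)
qed

text \<open>Each product of powers in \<open>toric_hom\<close> collapses to a single monomial, so
  the homomorphism merely relabels exponents by their degree and adds up coefficients within a
  degree.\<close>

lemma toric_hom_eq:
  "toric_hom a p =
    (\<Sum>m\<in>Poly_Mapping.keys p. Poly_Mapping.single (total_degree a m) (Poly_Mapping.lookup p m))"
proof -
  have "(\<Sum>i\<in>UNIV. (m $ Inl i) *s axis i 1) = x_part m" for m :: "nat ^ ('a + 'b)"
    by (simp add: x_part_def vec_eq_iff axis_def if_distrib[of "\<lambda>x. _ * x"] cong: if_cong)
  moreover have "(\<Sum>j\<in>UNIV. (m $ Inr j) *s a j) = S_degree a (y_part m)" for m :: "nat ^ ('a + 'b)"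
    by (simp add: S_degree_def y_part_def)
  ultimately show ?thesis
    unfolding toric_hom_def by (simp add: prod_monomial_power mult_single total_degree_def)
qed

text \<open>Enlarging the index set adds only zero coefficients. This allows several polynomials to
  be summed over a common set although cancellation may shrink supports.\<close>

lemma toric_hom_superset:
  assumes "finite A" "Poly_Mapping.keys p \<subseteq> A"
  shows "toric_hom a p =
    (\<Sum>m\<in>A. Poly_Mapping.single (total_degree a m) (Poly_Mapping.lookup p m))"
  unfolding toric_hom_eq using assms by (intro sum.mono_neutral_left) (auto simp: in_keys_iff)

lemma toric_hom_diff: "toric_hom a (p - q) = toric_hom a p - toric_hom a q"
proof -
  let ?A = "Poly_Mapping.keys p \<union> Poly_Mapping.keys q"
  have "finite ?A" by simp
  then show ?thesis
    using toric_hom_superset[of ?A _ a] keys_diff[of p q]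
    by (simp add: lookup_minus single_diff sum_subtractf)
qed

lemma toric_hom_single_mult:
  "toric_hom a (Poly_Mapping.single t c * p) = Poly_Mapping.single (total_degree a t) c * toric_hom a p"
proof -
  have "toric_hom a (Poly_Mapping.single t c * p) =
    (\<Sum>m\<in>(+) t ` Poly_Mapping.keys p. Poly_Mapping.single (total_degree a m)
      (Poly_Mapping.lookup (Poly_Mapping.single t c * p) m))"
    by (rule toric_hom_superset) (auto intro: keys_single_mult[THEN subsetD])
  also have "\<dots> = Poly_Mapping.single (total_degree a t) c * toric_hom a p"
    by (simp add: sum.reindex lookup_single_mult total_degree_add toric_hom_eq sum_distrib_left mult_single)
  finally show ?thesis .
qed

lemma toric_hom_monomial: "toric_hom a (monomial m) = monomial (total_degree a m)"
  by (simp add: toric_hom_eq)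

text \<open>If \<open>m\<close> were the only key of its degree, its nonzero coefficient would
  survive as a coefficient of the image, which is zero.\<close>

lemma toric_ideal_same_degree_key:
  assumes "p \<in> toric_ideal a" "m \<in> Poly_Mapping.keys p"
  obtains m' where "m' \<in> Poly_Mapping.keys p" "m' \<noteq> m" "total_degree a m' = total_degree a m"
proof (rule ccontr)
  assume "\<not> thesis"
  with that have only: "total_degree a m' \<noteq> total_degree a m"
    if "m' \<in> Poly_Mapping.keys p" "m' \<noteq> m" for m' using that by blast
  have "0 = Poly_Mapping.lookup (toric_hom a p) (total_degree a m)"
    using assms(1) by (simp add: toric_ideal_def)
  also have "\<dots> = (\<Sum>m'\<in>Poly_Mapping.keys p. if m' = m then Poly_Mapping.lookup p m else 0)"
    unfolding toric_hom_eq lookup_sum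
    by (intro sum.cong) (auto simp: lookup_single when_def only)
  also have "\<dots> = Poly_Mapping.lookup p m" using assms(2) by simp
  finally show False using assms(2) by (simp add: in_keys_iff)
qed

text \<open>Suppose \<open>m\<close> is a shift by \<open>t\<close> of the leading exponent of some
  \<open>g\<close> in the basis. Then \<open>g\<close> has another key of the same degree as its
  leading one; it is smaller, and its shift by \<open>t\<close> is a monomial of the degree of
  \<open>m\<close> lying below \<open>m\<close>.\<close>

lemma minimal_not_in_lead_exps:
  assumes ord: "monomial_order prec" and gb: "groebner_basis prec (toric_ideal a) G"
    and min: "\<And>w. total_degree a w = total_degree a m \<Longrightarrow> \<not> prec w m"
  shows "m \<notin> lead_exps prec G"
proof
  note D = monomial_orderD[OF ord]
  assume "m \<in> lead_exps prec G"
  then obtain g t where g: "g \<in> G" "m = lead_exp prec g + t" unfolding lead_exps_def by blast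
  then have gI: "g \<in> toric_ideal a" "g \<noteq> 0" using gb unfolding groebner_basis_def by auto
  note L = lead_exp_greatest[OF D(1) gI(2)]
  obtain l where l: "l \<in> Poly_Mapping.keys g" "l \<noteq> lead_exp prec g"
    "total_degree a l = total_degree a (lead_exp prec g)"
    using toric_ideal_same_degree_key[OF gI(1) L(1)] .
  have "prec (l + t) m" using D(3)[OF L(2)[OF l(1,2)], of t] g(2) by simp
  moreover have "total_degree a (l + t) = total_degree a m"
    using l(3) g(2) by (simp add: total_degree_add)
  ultimately show False using min by blast
qed

text \<open>The difference of two monomials of equal degree is in the toric ideal, and the minimal
  monomial of the degree is irreducible.\<close>

lemma normal_form_monomial_toric:
  assumes ord: "monomial_order prec" and gb: "groebner_basis prec (toric_ideal a) G"
    and deg: "total_degree a m' = total_degree a m"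
    and min: "\<And>w. total_degree a w = total_degree a m \<Longrightarrow> \<not> prec w m"
  shows "normal_form prec G (monomial m') = monomial m"
proof (rule normal_form_eqI[OF ord gb])
  show "monomial m' - monomial m \<in> toric_ideal a"
    using deg by (simp add: toric_ideal_def toric_hom_diff toric_hom_monomial)
  show "Poly_Mapping.keys (monomial m) \<inter> lead_exps prec G = {}"
    using minimal_not_in_lead_exps[OF ord gb min] by simp
qed (simp_all add: toric_ideal_def toric_hom_diff toric_hom_single_mult, simp add: toric_hom_eq)

section \<open>The elimination order\<close>

lemma finite_vec_bounded: "finite {u :: nat ^ 'k::finite. \<forall>j. u $ j \<le> n}"
proof -
  have "{u :: nat ^ 'k. \<forall>j. u $ j \<le> n} \<subseteq> vec_lambda ` (PiE UNIV (\<lambda>_. {..n}))"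
    by (auto simp: image_iff PiE_iff intro!: bexI[of _ "vec_nth _"])
  then show ?thesis by (rule finite_subset) (simp add: finite_PiE)
qed

text \<open>Each \<open>a j\<close> has a positive coordinate, so the exponent \<open>u $ j\<close>
  is bounded by that coordinate of \<open>v\<close>. Finite fibres are what makes the graded order
  well-founded, since reverse lexicographic comparison alone has infinite descending chains.\<close>

lemma finite_S_degree_fibre:
  fixes a :: "'k::finite \<Rightarrow> nat ^ 'd::finite"
  assumes "\<forall>j. a j \<noteq> 0"
  shows "finite {u. S_degree a u = v}"
proof (rule finite_subset)
  show "{u. S_degree a u = v} \<subseteq> {u. \<forall>j. u $ j \<le> (\<Sum>i\<in>UNIV. v $ i)}"
  proof clarify
    fix u j assume v: "v = S_degree a u"
    from assms obtain i where i: "a j $ i \<noteq> 0" by (metis vec_eq_iff zero_index)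
    have "u $ j \<le> u $ j * a j $ i" using i by simp
    also have "\<dots> \<le> (\<Sum>j\<in>UNIV. u $ j * a j $ i)"
      by (rule member_le_sum) auto
    also have "\<dots> = v $ i" by (simp add: v S_degree_def)
    also have "\<dots> \<le> (\<Sum>i\<in>UNIV. v $ i)" by (rule member_le_sum) auto
    finally show "u $ j \<le> (\<Sum>i\<in>UNIV. S_degree a u $ i)" by (simp add: v)
  qed
qed (rule finite_vec_bounded)

lemma ex_smallest_difference:
  assumes "strict_total vless" "u \<noteq> (v :: 'b ^ 'k::finite)"
  obtains i where "u $ i \<noteq> v $ i" "\<forall>j. vless j i \<longrightarrow> u $ j = v $ j"
proof -
  have "{i. u $ i \<noteq> v $ i} \<noteq> {}" using assms(2) by (simp add: vec_eq_iff)
  then obtain i where i: "u $ i \<noteq> v $ i" "\<forall>j. u $ j \<noteq> v $ j \<longrightarrow> j \<noteq> i \<longrightarrow> vless i j"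
    using strict_total_ex_least[OF assms(1), of "{i. u $ i \<noteq> v $ i}"] by auto
  have "u $ j = v $ j" if "vless j i" for j
  proof (rule ccontr)
    assume "u $ j \<noteq> v $ j"
    then have "vless i j" using i(2) that strict_totalD(1)[OF assms(1)] by blast
    then show False using strict_totalD(1,2)[OF assms(1)] that by blast
  qed
  with that i show ?thesis by blast
qed

lemma strict_total_S_graded_revlex:
  assumes g: "strict_total gless" and v: "strict_total vless"
  shows "strict_total (S_graded_revlex a gless vless)"
  unfolding strict_total_def
proof (intro conjI irreflpI transpI totalpI)
  note G = strict_totalD[OF g] and V = strict_totalD[OF v]
  let ?L = "S_graded_revlex a gless vless"
  show "\<not> ?L x x" for x using G(1) by (auto simp: S_graded_revlex_def)
  show "?L x z" if xy: "?L x y" and yz: "?L y z" for x y z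
  proof (cases "S_degree a x = S_degree a y \<and> S_degree a y = S_degree a z")
    case False
    then have "gless (S_degree a x) (S_degree a z)"
      using xy yz G(2)[of "S_degree a x" "S_degree a y" "S_degree a z"]
      unfolding S_graded_revlex_def by metis
    then show ?thesis by (simp add: S_graded_revlex_def)
  next
    case True
    then obtain i j where i: "x $ i > y $ i" "\<And>l. vless l i \<Longrightarrow> x $ l = y $ l"
      and j: "y $ j > z $ j" "\<And>l. vless l j \<Longrightarrow> y $ l = z $ l"
      using xy yz G(1) unfolding S_graded_revlex_def by metis
    \<comment> \<open>The smaller of the two deciding variables \<open>i\<close> and
      \<open>j\<close> decides between \<open>x\<close> and \<open>z\<close>.\<close>
    consider "i = j" | "vless i j" | "vless j i" using V(3) by blast
    then have "\<exists>i. x $ i > z $ i \<and> (\<forall>l. vless l i \<longrightarrow> x $ l = z $ l)"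
    proof cases
      case 1
      then show ?thesis using i j by (intro exI[of _ i]) auto
    next
      case 2
      then show ?thesis using i j V(2) by (intro exI[of _ i]) fastforce
    next
      case 3
      then show ?thesis using i j V(2) by (intro exI[of _ j]) fastforce
    qed
    then show ?thesis using True by (simp add: S_graded_revlex_def)
  qed
  show "?L x y \<or> ?L y x" if ne: "x \<noteq> y" for x y
  proof (cases "S_degree a x = S_degree a y")
    case False
    show ?thesis using G(3)[OF False] by (auto simp only: S_graded_revlex_def)
  next
    case True
    obtain i where i: "x $ i \<noteq> y $ i" "\<forall>j. vless j i \<longrightarrow> x $ j = y $ j"
      using ex_smallest_difference[OF v ne] .
    then have "x $ i > y $ i \<or> y $ i > x $ i" by linarith
    then show ?thesis
    proof
      assume "x $ i > y $ i"
      then have "?L x y" using True i(2) unfolding S_graded_revlex_def by blast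
      then show ?thesis ..
    next
      assume "y $ i > x $ i"
      then have "?L y x" using True i(2) unfolding S_graded_revlex_def by metis
      then show ?thesis ..
    qed
  qed
qed

text \<open>For well-foundedness, a minimal \<open>S\<close>-degree is chosen first; the elements of
  the given set in that degree form a finite set, which has a least element.\<close>

lemma monomial_order_S_graded_revlex:
  assumes nz: "\<forall>j. a j \<noteq> 0" and g: "monomial_order gless" and v: "strict_total vless"
  shows "monomial_order (S_graded_revlex a gless vless)"
  unfolding monomial_order_def
proof (intro conjI allI impI)
  note D = monomial_orderD[OF g]
  let ?L = "S_graded_revlex a gless vless"
  show st: "strict_total ?L" using D(1) v by (rule strict_total_S_graded_revlex)
  show "?L (u + w) (u' + w)" if "?L u u'" for u u' w
    using that D(3) by (auto simp: S_graded_revlex_def S_degree_add)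
  show "wfp ?L"
    unfolding wfp_iff_ex_minimal
  proof (intro allI impI)
    fix A :: "(nat ^ 'a) set"
    assume "A \<noteq> {}"
    then obtain s where s: "s \<in> S_degree a ` A" "\<And>t. gless t s \<Longrightarrow> t \<notin> S_degree a ` A"
      using wfp_ex_minimal[OF D(2)] by (metis ex_in_conv imageI)
    let ?F = "A \<inter> {u. S_degree a u = s}"
    obtain m where m: "m \<in> ?F" "\<forall>x\<in>?F. x \<noteq> m \<longrightarrow> ?L m x"
      using strict_total_ex_least[OF st, of ?F] finite_S_degree_fibre[OF nz, of s] s(1) by blast
    have "y \<notin> A" if y: "?L y m" for y
    proof
      assume "y \<in> A"
      moreover have "S_degree a m = s" using m(1) by simp
      ultimately have "y \<in> ?F" using y s(2) by (auto simp: S_graded_revlex_def)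
      then show False using m(2) y strict_totalD(1,2)[OF st] by metis
    qed
    with m(1) show "\<exists>z\<in>A. \<forall>y. ?L y z \<longrightarrow> y \<notin> A" by blast
  qed
qed

lemma monomial_order_block_order:
  fixes xless :: "nat ^ 'd::finite \<Rightarrow> nat ^ 'd \<Rightarrow> bool"
    and yless :: "nat ^ 'k::finite \<Rightarrow> nat ^ 'k \<Rightarrow> bool"
  assumes x: "monomial_order xless" and y: "monomial_order yless"
  shows "monomial_order (block_order xless yless)"
  unfolding monomial_order_def
proof (intro conjI allI impI)
  note X = monomial_orderD[OF x] and Y = monomial_orderD[OF y]
  note X1 = strict_totalD[OF X(1)] and Y1 = strict_totalD[OF Y(1)]
  let ?L = "block_order xless yless"
  show "strict_total ?L"
    unfolding strict_total_def
  proof (intro conjI irreflpI transpI totalpI)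
    show "\<not> ?L u u" for u using X1(1) Y1(1) by (auto simp: block_order_def)
    show "?L u w" if "?L u v" "?L v w" for u v w
      using that X1(2)[of "x_part u" "x_part v" "x_part w"]
        Y1(2)[of "y_part u" "y_part v" "y_part w"]
      unfolding block_order_def by auto
    show "?L u v \<or> ?L v u" if "u \<noteq> v" for u v
    proof -
      have "x_part u \<noteq> x_part v \<or> y_part u \<noteq> y_part v"
      proof (rule ccontr)
        assume "\<not> ?thesis"
        then have "u $ s = v $ s" for s
          by (cases s) (simp_all add: x_part_def y_part_def vec_eq_iff)
        with that show False by (simp add: vec_eq_iff)
      qed
      then show ?thesis
        using X1(3)[of "x_part u" "x_part v"] Y1(3)[of "y_part u" "y_part v"]
        unfolding block_order_def by metis
    qed
  qed
  show "?L (u + w) (v + w)" if "?L u v" for u v w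
    using that X(3) Y(3) by (auto simp: block_order_def)
  \<comment> \<open>The block order is the lexicographic product of the two orders, pulled back
    along the splitting of exponents into their blocks.\<close>
  have "wf (inv_image ({(u, v). xless u v} <*lex*> {(u, v). yless u v}) (\<lambda>w. (x_part w, y_part w)))"
    using X(2) Y(2) by (intro wf_inv_image wf_lex_prod) (simp_all add: wfp_def)
  moreover have "{(u, v). ?L u v} =
    inv_image ({(u, v). xless u v} <*lex*> {(u, v). yless u v}) (\<lambda>w. (x_part w, y_part w))"
    by (auto simp: block_order_def inv_image_def)
  ultimately show "wfp ?L" by (simp add: wfp_def)
qed

section \<open>Apery elements\<close>

definition y_exponent :: "nat ^ 'k::finite \<Rightarrow> nat ^ ('d::finite + 'k)" where
  "y_exponent u = (\<chi> s. case s of Inl i \<Rightarrow> 0 | Inr j \<Rightarrow> u $ j)"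

lemma part_exponent [simp]:
  "x_part (x_exponent v) = v" "y_part (x_exponent v) = 0"
  "x_part (y_exponent u) = 0" "y_part (y_exponent u) = u"
  by (simp_all add: x_part_def y_part_def x_exponent_def y_exponent_def vec_eq_iff)

lemma int_vec_diff_eq_iff: "int_vec s - int_vec b = int_vec t \<longleftrightarrow> s = t + b"
proof -
  have "int (s $ i) - int (b $ i) = int (t $ i) \<longleftrightarrow> s $ i = t $ i + b $ i" for i by linarith
  then show ?thesis by (simp add: int_vec_def vec_eq_iff)
qed

text \<open>Subtracting \<open>a j\<close> without leaving the monoid amounts to having a
  factorization in which \<open>a j\<close> occurs. Apery elements are thus described by
  factorizations, the form in which they meet the monomial order.\<close>

lemma mem_Apery_iff:
  fixes a :: "'k::finite \<Rightarrow> nat ^ 'd::finite"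
  shows "v \<in> Apery (affine_monoid a) (a ` Z) \<longleftrightarrow>
    v \<in> affine_monoid a \<and> (\<forall>u. S_degree a u = v \<longrightarrow> (\<forall>j\<in>Z. u $ j = 0))"
proof -
  have "int_vec v - int_vec (a j) \<in> int_vec ` affine_monoid a \<longleftrightarrow>
    (\<exists>u. S_degree a u = v \<and> u $ j \<noteq> 0)" (is "?l \<longleftrightarrow> ?r") for j
  proof
    assume ?l
    then obtain u where "v = S_degree a u + a j"
      by (auto simp: int_vec_diff_eq_iff affine_monoid_def)
    then have "S_degree a (u + axis j 1) = v" by (simp add: S_degree_add)
    then show ?r by (intro exI[of _ "u + axis j 1"]) (simp add: axis_def)
  next
    assume ?r
    then obtain u where u: "S_degree a u = v" "u $ j \<noteq> 0" by blast
    \<comment> \<open>One copy of \<open>a j\<close> is removed; the truncated subtraction is exact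
      because \<open>u $ j\<close> is nonzero.\<close>
    define u' where "u' = (\<chi> i. if i = j then u $ j - 1 else u $ i)"
    have "u = u' + axis j 1" using u(2) by (auto simp: u'_def vec_eq_iff axis_def)
    then have "v = S_degree a u' + a j" using u(1) by (simp add: S_degree_add)
    then have "int_vec v - int_vec (a j) = int_vec (S_degree a u')"
      by (simp only: int_vec_diff_eq_iff)
    then show ?l by (auto simp: affine_monoid_def)
  qed
  then show ?thesis by (auto simp: Apery_def)
qed

text \<open>Here the shape of the order enters: the block structure controls the
  \<open>x\<close>-part of the minimal monomial \<open>m\<close>, and the reverse lexicographic
  tie-break controls its exponents in \<open>Z\<close>.\<close>

lemma minimal_exponent_Apery_iff:
  assumes x: "monomial_order xless" and v: "strict_total vless"
    and Z_smaller: "\<forall>i\<in>Z. \<forall>j\<in>- Z. vless i j"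
    and min: "\<And>w. total_degree a w = total_degree a m \<Longrightarrow>
      \<not> block_order xless (S_graded_revlex a gless vless) w m"
  shows "(\<forall>i. m $ Inl i = 0) \<and> (\<forall>j\<in>Z. m $ Inr j = 0) \<longleftrightarrow>
    total_degree a m \<in> Apery (affine_monoid a) (a ` Z)"
proof
  let ?v = "total_degree a m"
  have yu: "total_degree a (y_exponent u) = S_degree a u" for u
    by (simp add: total_degree_def)
  assume m0: "(\<forall>i. m $ Inl i = 0) \<and> (\<forall>j\<in>Z. m $ Inr j = 0)"
  then have xm: "x_part m = 0" and ym: "\<And>j. j \<in> Z \<Longrightarrow> y_part m $ j = 0"
    by (simp_all add: x_part_def y_part_def vec_eq_iff)
  then have deg: "?v = S_degree a (y_part m)" by (simp add: total_degree_def)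
  have "u $ j = 0" if u: "S_degree a u = ?v" and j: "j \<in> Z" for u j
  proof (rule ccontr)
    assume uj: "u $ j \<noteq> 0"
    then have ne: "u $ j \<noteq> y_part m $ j" using ym j by simp
    then have ne': "u \<noteq> y_part m" by blast
    obtain i where i: "u $ i \<noteq> y_part m $ i" "\<forall>l. vless l i \<longrightarrow> u $ l = y_part m $ l"
      using ex_smallest_difference[OF v ne'] .
    \<comment> \<open>Were \<open>i\<close> outside \<open>Z\<close>, then \<open>j\<close> would be
      a smaller variable than \<open>i\<close> in which \<open>u\<close> and \<open>y_part m\<close>
      differ. As \<open>m\<close> vanishes on \<open>Z\<close>, \<open>u\<close> has the larger
      exponent at \<open>i\<close> and is therefore the smaller monomial.\<close>
    have "i \<in> Z" using i(2) ne Z_smaller j by blast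
    then have "u $ i > y_part m $ i" using i(1) ym by simp
    then have "S_graded_revlex a gless vless u (y_part m)"
      using i(2) u deg by (auto simp: S_graded_revlex_def)
    then have "block_order xless (S_graded_revlex a gless vless) (y_exponent u) m"
      using xm by (simp add: block_order_def)
    then show False using min[of "y_exponent u"] yu u by simp
  qed
  moreover have "?v \<in> affine_monoid a" using deg by (auto simp: affine_monoid_def)
  ultimately show "?v \<in> Apery (affine_monoid a) (a ` Z)" unfolding mem_Apery_iff by blast
next
  let ?v = "total_degree a m"
  assume "?v \<in> Apery (affine_monoid a) (a ` Z)"
  then obtain u where u: "S_degree a u = ?v"
    and Z: "\<forall>u. S_degree a u = ?v \<longrightarrow> (\<forall>j\<in>Z. u $ j = 0)"
    unfolding mem_Apery_iff by (auto simp: affine_monoid_def)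
  have "total_degree a (y_exponent u) = ?v" using u by (simp add: total_degree_def)
  \<comment> \<open>A factorization \<open>u\<close> gives a competitor with trivial
    \<open>x\<close>-part, which forces that of \<open>m\<close> to be trivial too. Then
    \<open>y_part m\<close> is itself a factorization, to which the Apery condition \<open>Z\<close>
    applies.\<close>
  then have "\<not> xless 0 (x_part m)" using min[of "y_exponent u"] by (simp add: block_order_def)
  then have xm: "x_part m = 0" using monomial_order_zero_least[OF x] by blast
  then have "y_part m $ j = 0" if "j \<in> Z" for j
    using Z that by (simp add: total_degree_def)
  with xm show "(\<forall>i. m $ Inl i = 0) \<and> (\<forall>j\<in>Z. m $ Inr j = 0)"
    by (simp add: x_part_def y_part_def vec_eq_iff)
qed

theorem theorem8:
  fixes a :: "'k::finite \<Rightarrow> nat ^ 'd::finite"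
    and Z :: "'k set"
    and xless gless :: "nat ^ 'd \<Rightarrow> nat ^ 'd \<Rightarrow> bool"
    and vless :: "'k \<Rightarrow> 'k \<Rightarrow> bool"
    and prec :: "nat ^ ('d + 'k) \<Rightarrow> nat ^ ('d + 'k) \<Rightarrow> bool"
    and B :: "('d + 'k) mpol set"
  assumes nonzero: "\<forall>j. a j \<noteq> 0"
    and cone: "rat_cone (range a) = rat_cone (a ` Z)"
    and xless: "monomial_order xless"
    and gless: "monomial_order gless"
    and vless: "strict_total vless"
    and Z_smaller: "\<forall>i\<in>Z. \<forall>j\<in>- Z. vless i j"
    and prec_def: "prec = block_order xless (S_graded_revlex a gless vless)"
    and B: "reduced_groebner_basis prec (toric_ideal a) B"
  shows "Q_set prec B Z = Apery (affine_monoid a) (a ` Z)"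
proof (rule set_eqI)
  fix v
  have ord: "monomial_order prec"
    unfolding prec_def
    using monomial_order_block_order[OF xless monomial_order_S_graded_revlex[OF nonzero gless vless]] .
  have gb: "groebner_basis prec (toric_ideal a) B"
    using B by (simp add: reduced_groebner_basis_def)
  have deg_x: "total_degree a (x_exponent v) = v" by (simp add: total_degree_def)
  \<comment> \<open>Every degree \<open>v\<close> contains at least the monomial with exponent
    \<open>x_exponent v\<close>, so a minimal monomial \<open>m\<close> of degree \<open>v\<close>
    exists.\<close>
  then have "x_exponent v \<in> {w. total_degree a w = v}" by simp
  from wfp_ex_minimal[OF monomial_orderD(2)[OF ord] this]
  obtain m where "m \<in> {w. total_degree a w = v}"
    "\<forall>w. prec w m \<longrightarrow> w \<notin> {w. total_degree a w = v}" .
  then have m: "total_degree a m = v"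
    and min: "\<And>w. total_degree a w = total_degree a m \<Longrightarrow> \<not> prec w m"
    by auto
  have "normal_form prec B (monomial (x_exponent v)) = monomial m"
    using normal_form_monomial_toric[OF ord gb _ min] deg_x m by simp
  \<comment> \<open>The complement condition in \<open>Q_set\<close> holds automatically for
    \<open>m\<close>, so only the vanishing of coordinates remains to be decided.\<close>
  moreover have "m \<notin> lead_exps prec B"
    using minimal_not_in_lead_exps[OF ord gb min] .
  ultimately have "v \<in> Q_set prec B Z \<longleftrightarrow>
      (\<forall>i. m $ Inl i = 0) \<and> (\<forall>j\<in>Z. m $ Inr j = 0)"
    by (simp add: Q_set_def lead_exp_monomial)
  also have "\<dots> \<longleftrightarrow> v \<in> Apery (affine_monoid a) (a ` Z)"
    using minimal_exponent_Apery_iff[OF xless vless Z_smaller min[unfolded prec_def]] m by simp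
  finally show "v \<in> Q_set prec B Z \<longleftrightarrow> v \<in> Apery (affine_monoid a) (a ` Z)" .
qed

end
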